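(* Let $V$ be a finite-dimensional real vector space equipped with a norm $\|\cdot\|$, with dual space $V^*$ and dual norm $\|\cdot\|_*$. Let $K\subseteq V$ be any non-empty bounded closed convex subset, and let $D=\sup_{u,v\in K}\|u-v\|$ be the diameter of $K$. Let $A$ be any (possibly randomized) algorithm for online linear optimization on $K$. Let $T$ be any non-negative integer and let $a_1,a_2,\dots,a_T$ be any non-negative real numbers. There exists a sequence of vectors $\ell_1,\ell_2,\dots,\ell_T$ in the dual vector space $V^*$ such that $\|\ell_1\|_*=a_1,\ \|\ell_2\|_*=a_2,\dots,\|\ell_T\|_*=a_T$ and the regret of algorithm $A$ satisfies $$\mathrm{Regret}_T\ge\frac{D}{\sqrt{8}}\sqrt{\sum_{t=1}^T\|\ell_t\|_*^2}.$$
   Context: Online linear optimization on $K$: in each round $t=1,2,\dots$ the algorithm chooses a point $w_t\in K$ and then observes a loss vector $\ell_t\in V^*$; its loss in round $t$ is $\langle\ell_t,w_t\rangle$, where $\langle\cdot,\cdot\rangle:V^*\times V\to\mathbb{R}$ is the bilinear pairing of $V^*$ and $V$. The regret with respect to $u\in K$ is $\mathrm{Regret}_T(u)=\sum_{t=1}^T\langle\ell_t,w_t\rangle-\sum_{t=1}^T\langle\ell_t,u\rangle$, and $\mathrm{Regret}_T=\sup_{u\in K}\mathrm{Regret}_T(u)$.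
   Formalization: It is assumed that V is nonzero or all a_t are 0, since for V = {0} the dual has no vector of norm a_t > 0; for a randomized algorithm the regret bound is for the expected regret, with the loss vectors fixed before the algorithm's randomness is drawn. *)

theory Defs
  imports "HOL-Probability.Probability"
begin

text \<open>
  The dual space of a finite-dimensional normed space \<open>'v\<close> is the type \<open>'v \<Rightarrow>\<^sub>L real\<close>: every linear
  functional on such a space is bounded, \<open>norm\<close> on this type is the operator norm, i.e. the dual
  norm, and the pairing is \<open>blinfun_apply\<close>.

  A deterministic strategy maps the list of the losses observed so far to the next point.  Rounds are
  numbered from 1.
\<close>

definition play :: "(('v::real_normed_vector \<Rightarrow>\<^sub>L real) list \<Rightarrow> 'v) \<Rightarrow> (nat \<Rightarrow> 'v \<Rightarrow>\<^sub>L real) \<Rightarrow> nat \<Rightarrow> 'v"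
  where "play S l t = S (map l [1..<t])"

text \<open>
  A randomized algorithm draws a seed \<open>\<omega>\<close> from a probability space \<open>M\<close>, independently of the losses,
  and then runs the deterministic strategy \<open>A \<omega>\<close>.  Deterministic algorithms are those for which
  \<open>A \<omega>\<close> does not depend on \<open>\<omega>\<close>.
\<close>

definition randomized_algorithm ::
    "'v::real_normed_vector set \<Rightarrow> 's measure \<Rightarrow> ('s \<Rightarrow> ('v \<Rightarrow>\<^sub>L real) list \<Rightarrow> 'v) \<Rightarrow> bool"
  where "randomized_algorithm K M A \<longleftrightarrow>
    prob_space M \<and>
    (\<forall>h. (\<lambda>\<omega>. A \<omega> h) \<in> borel_measurable M) \<and>
    (\<forall>h. \<forall>\<omega>\<in>space M. A \<omega> h \<in> K)"

definition regret_wrt ::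
    "(nat \<Rightarrow> 'v::real_normed_vector) \<Rightarrow> (nat \<Rightarrow> 'v \<Rightarrow>\<^sub>L real) \<Rightarrow> nat \<Rightarrow> 'v \<Rightarrow> real"
  where "regret_wrt w l T u =
    (\<Sum>t = 1..T. blinfun_apply (l t) (w t)) - (\<Sum>t = 1..T. blinfun_apply (l t) u)"

definition regret ::
    "'v::real_normed_vector set \<Rightarrow> (nat \<Rightarrow> 'v) \<Rightarrow> (nat \<Rightarrow> 'v \<Rightarrow>\<^sub>L real) \<Rightarrow> nat \<Rightarrow> real"
  where "regret K w l T = (SUP u\<in>K. regret_wrt w l T u)"

text \<open>
  The losses \<open>l\<close> are fixed before the seed is drawn (oblivious adversary).  For bounded nonempty
  \<open>K\<close> the regret is a bounded measurable function of the seed, so this integral is the genuine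
  expectation.
\<close>

definition expected_regret ::
    "'v::real_normed_vector set \<Rightarrow> 's measure \<Rightarrow> ('s \<Rightarrow> ('v \<Rightarrow>\<^sub>L real) list \<Rightarrow> 'v) \<Rightarrow>
      (nat \<Rightarrow> 'v \<Rightarrow>\<^sub>L real) \<Rightarrow> nat \<Rightarrow> real"
  where "expected_regret K M A l T = (\<integral>\<omega>. regret K (play (A \<omega>) l) l T \<partial>M)"

end

(*
  Take u, v in K at distance D and a norm-one functional L with L (u - v) = D, and play the losses
  e_t a_t L with independent uniform signs e_t.  The point chosen in round t does not depend on e_t,
  so averaging over the signs kills the loss of the algorithm up to a constant, and comparing with
  the better of u and v leaves D/2 times the mean of |sum e_t a_t|.  Khintchine's inequality with the
  optimal constant 1/sqrt 2 concludes.  Following Latala and Oleszkiewicz, it comes from the Poincare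
  inequality on the discrete cube, whose constant improves by a factor 2 for even functions such
  as |sum e_t a_t|.
*)

theory Submission
  imports Defs
begin

subsection \<open>Khintchine's inequality on the discrete cube\<close>

text \<open>Expectation under independent uniform signs. The head of the list is the first sign:
  inductions condition on it, and \<open>take i x\<close> is the history known before the next sign
  is drawn.\<close>

primrec cube_mean :: "nat \<Rightarrow> (real list \<Rightarrow> real) \<Rightarrow> real" where
  "cube_mean 0 F = F []"
| "cube_mean (Suc n) F = (cube_mean n (\<lambda>x. F (1 # x)) + cube_mean n (\<lambda>x. F ((-1) # x))) / 2"

lemma cube_mean_add: "cube_mean n (\<lambda>x. F x + G x) = cube_mean n F + cube_mean n G"
  by (induction n arbitrary: F G) (simp_all add: field_simps)

lemma cube_mean_cmult: "cube_mean n (\<lambda>x. c * F x) = c * cube_mean n F"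
  by (induction n arbitrary: F) (simp_all add: field_simps)

lemma cube_mean_const: "cube_mean n (\<lambda>x. c) = c"
  by (induction n) simp_all

lemma cube_mean_mono:
  "(\<And>x. length x = n \<Longrightarrow> F x \<le> G x) \<Longrightarrow> cube_mean n F \<le> cube_mean n G"
proof (induction n arbitrary: F G)
  case (Suc n)
  then show ?case by (auto intro!: add_mono divide_right_mono)
qed simp

lemma cube_mean_cong:
  "(\<And>x. length x = n \<Longrightarrow> F x = G x) \<Longrightarrow> cube_mean n F = cube_mean n G"
  by (intro antisym cube_mean_mono) auto

lemma cube_mean_nonneg: "(\<And>x. 0 \<le> F x) \<Longrightarrow> 0 \<le> cube_mean n F"
  using cube_mean_mono[of n "\<lambda>_. 0" F] by (simp add: cube_mean_const)

text \<open>The probabilistic method: it extracts one sign pattern from an average. The range of the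
  entries is recorded because the norms of the losses depend on it.\<close>

lemma cube_mean_le_value:
  "\<exists>x. length x = n \<and> set x \<subseteq> {1, -1} \<and> cube_mean n F \<le> F x"
proof (induction n arbitrary: F)
  case (Suc n)
  obtain x where x: "length x = n" "set x \<subseteq> {1, -1}" "cube_mean n (\<lambda>x. F (1 # x)) \<le> F (1 # x)"
    using Suc[of "\<lambda>x. F (1 # x)"] by blast
  obtain y where y: "length y = n" "set y \<subseteq> {1, -1}" "cube_mean n (\<lambda>x. F ((-1) # x)) \<le> F ((-1) # y)"
    using Suc[of "\<lambda>x. F ((-1) # x)"] by blast
  have "cube_mean (Suc n) F \<le> F (1 # x) \<or> cube_mean (Suc n) F \<le> F ((-1) # y)"
    using x(3) y(3) by (simp add: field_simps) linarith
  moreover have "length (1 # x) = Suc n" "set (1 # x) \<subseteq> {1, -1}"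
      "length ((-1) # y) = Suc n" "set ((-1) # y) \<subseteq> {1, -1}"
    using x(1,2) y(1,2) by auto
  ultimately show ?case by blast
qed simp

text \<open>The factor \<phi> sees only earlier signs, so each product has mean zero. In the
  induction the first terms of the two halves are plus and minus \<open>\<phi> []\<close>, and the
  rest is the hypothesis for \<phi> with the first sign prepended.\<close>

lemma cube_mean_martingale: "cube_mean n (\<lambda>x. \<Sum>i<n. x ! i * \<phi> (take i x)) = 0"
proof (induction n arbitrary: \<phi>)
  case (Suc n)
  have "cube_mean n (\<lambda>x. \<Sum>i<Suc n. (e # x) ! i * \<phi> (take i (e # x))) = e * \<phi> []" for e
    using Suc[of "\<lambda>h. \<phi> (e # h)"]
    by (simp del: sum.lessThan_Suc add: sum.lessThan_Suc_shift cube_mean_add cube_mean_const)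
  then show ?case
    by (simp del: sum.lessThan_Suc)
qed simp

section \<open>Dirichlet form and Poincare inequalities on the discrete cube\<close>

definition flip_sum :: "(real list \<Rightarrow> real) \<Rightarrow> real list \<Rightarrow> real" where
  "flip_sum F x = (\<Sum>i<length x. F (x[i := - x ! i]))"

lemma flip_sum_Cons: "flip_sum F (e # x) = F ((- e) # x) + flip_sum (\<lambda>y. F (e # y)) x"
  unfolding flip_sum_def by (simp del: sum.lessThan_Suc add: sum.lessThan_Suc_shift)

text \<open>The mean of F times N F, where N F is the sum over coordinates of half the change of F
  under a flip. This operator form suits the pointwise estimate used for Khintchine.\<close>

definition dirichlet :: "nat \<Rightarrow> (real list \<Rightarrow> real) \<Rightarrow> real" where
  "dirichlet n F = cube_mean n (\<lambda>x. F x * (real n * F x - flip_sum F x)) / 2"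

lemma dirichlet_0 [simp]: "dirichlet 0 F = 0"
  by (simp add: dirichlet_def flip_sum_def)

text \<open>Flipping the first sign swaps the halves p and q, and p (p - q) + q (q - p) = (p - q)^2;
  all other flips stay inside a half.\<close>

lemma dirichlet_Suc:
  "dirichlet (Suc n) F = (dirichlet n (\<lambda>x. F (1 # x)) + dirichlet n (\<lambda>x. F ((-1) # x))) / 2
     + cube_mean n (\<lambda>x. ((F (1 # x) - F ((-1) # x)) / 2)\<^sup>2)"
proof -
  let ?p = "\<lambda>x. F (1 # x)" and ?q = "\<lambda>x. F ((-1) # x)"
  have "4 * dirichlet (Suc n) F =
      cube_mean n (\<lambda>x. ?p x * (real (Suc n) * ?p x - (?q x + flip_sum ?p x)))
      + cube_mean n (\<lambda>x. ?q x * (real (Suc n) * ?q x - (?p x + flip_sum ?q x)))"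
    by (simp add: dirichlet_def flip_sum_Cons)
  also have "\<dots> = cube_mean n (\<lambda>x. ?p x * (real n * ?p x - flip_sum ?p x)
      + ?q x * (real n * ?q x - flip_sum ?q x) + (?p x - ?q x)\<^sup>2)"
    unfolding cube_mean_add[symmetric]
    by (rule cube_mean_cong) (simp add: power2_eq_square algebra_simps)
  also have "\<dots> = 2 * dirichlet n ?p + 2 * dirichlet n ?q
      + cube_mean n (\<lambda>x. 4 * ((?p x - ?q x) / 2)\<^sup>2)"
    by (simp add: dirichlet_def cube_mean_add power_divide)
  finally show ?thesis by (simp only: cube_mean_cmult) argo
qed

lemma dirichlet_nonneg: "0 \<le> dirichlet n F"
  by (induction n arbitrary: F) (simp_all add: dirichlet_Suc cube_mean_nonneg)

text \<open>Parallelogram law of a quadratic form: p = s + t and q = s - t, \<open>flip_sum\<close>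
  is linear, and the cross terms cancel.\<close>

lemma dirichlet_parallelogram:
  "(dirichlet n p + dirichlet n q) / 2 =
     dirichlet n (\<lambda>x. (p x + q x) / 2) + dirichlet n (\<lambda>x. (p x - q x) / 2)"
proof -
  let ?s = "\<lambda>x. (p x + q x) / 2" and ?t = "\<lambda>x. (p x - q x) / 2"
  have fp: "flip_sum p x = flip_sum ?s x + flip_sum ?t x"
    and fq: "flip_sum q x = flip_sum ?s x - flip_sum ?t x" for x
    unfolding flip_sum_def sum.distrib[symmetric] sum_subtractf[symmetric]
    by (auto intro!: sum.cong simp: field_simps)
  have "dirichlet n p + dirichlet n q = cube_mean n (\<lambda>x. p x * (real n * p x - flip_sum p x)
      + q x * (real n * q x - flip_sum q x)) / 2"
    by (simp add: dirichlet_def cube_mean_add add_divide_distrib)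
  also have "\<dots> = cube_mean n (\<lambda>x. 2 * (?s x * (real n * ?s x - flip_sum ?s x)
      + ?t x * (real n * ?t x - flip_sum ?t x))) / 2"
    unfolding fp fq
    by (intro arg_cong2[where f = "(/)"] refl cube_mean_cong) (simp add: field_simps)
  also have "\<dots> = 2 * (dirichlet n ?s + dirichlet n ?t)"
    by (simp only: cube_mean_cmult cube_mean_add dirichlet_def) simp
  finally show ?thesis by simp
qed

lemma cube_mean_Suc_square:
  "cube_mean (Suc n) (\<lambda>x. (F x)\<^sup>2) =
     cube_mean n (\<lambda>x. ((F (1 # x) + F ((-1) # x)) / 2)\<^sup>2)
     + cube_mean n (\<lambda>x. ((F (1 # x) - F ((-1) # x)) / 2)\<^sup>2)"
proof -
  have "2 * cube_mean (Suc n) (\<lambda>x. (F x)\<^sup>2) = cube_mean n (\<lambda>x. (F (1 # x))\<^sup>2 + (F ((-1) # x))\<^sup>2)"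
    by (simp add: cube_mean_add)
  also have "\<dots> = cube_mean n (\<lambda>x. 2 * (((F (1 # x) + F ((-1) # x)) / 2)\<^sup>2
       + ((F (1 # x) - F ((-1) # x)) / 2)\<^sup>2))"
    by (rule cube_mean_cong) (simp add: power2_sum power2_diff power_divide, argo)
  finally show ?thesis by (simp only: cube_mean_cmult cube_mean_add) simp
qed

text \<open>Walsh terms involving the first coordinate come from the half-difference with their
  level raised by one; the last summand pays for that extra level.\<close>

lemma dirichlet_Suc':
  "dirichlet (Suc n) F = dirichlet n (\<lambda>x. (F (1 # x) + F ((-1) # x)) / 2)
     + dirichlet n (\<lambda>x. (F (1 # x) - F ((-1) # x)) / 2)
     + cube_mean n (\<lambda>x. ((F (1 # x) - F ((-1) # x)) / 2)\<^sup>2)"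
  by (simp add: dirichlet_Suc dirichlet_parallelogram)

text \<open>
  In terms of Walsh coefficients, \<open>dirichlet\<close> gives level \<open>k\<close> the weight \<open>k\<close>; the next two inequalities
  say \<open>k \<ge> 1\<close> for odd \<open>k\<close> and \<open>k + [k odd] \<ge> 2\<close> for \<open>k \<ge> 1\<close>.  Splitting off the first coordinate
  exchanges even and odd in the antisymmetric half, which makes the pair inductive.
\<close>

lemma poincare_odd_part:
  "cube_mean n (\<lambda>x. (F x)\<^sup>2) \<le> dirichlet n F + cube_mean n (\<lambda>x. ((F x + F (map uminus x)) / 2)\<^sup>2)"
proof (induction n arbitrary: F)
  case (Suc n)
  define s where "s x = (F (1 # x) + F ((-1) # x)) / 2" for x
  define t where "t x = (F (1 # x) - F ((-1) # x)) / 2" for x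
  \<comment> \<open>Global negation sends s + e t to s - e t evaluated at the negated tail, so the
    even part of F consists of the even part of s and the odd part of t.\<close>
  have "cube_mean (Suc n) (\<lambda>x. ((F x + F (map uminus x)) / 2)\<^sup>2)
      = cube_mean n (\<lambda>x. ((s x + s (map uminus x)) / 2)\<^sup>2)
      + cube_mean n (\<lambda>x. ((t x - t (map uminus x)) / 2)\<^sup>2)"
    unfolding cube_mean_Suc_square
    by (intro arg_cong2[where f = "(+)"] cube_mean_cong) (simp_all add: s_def t_def field_simps)
  moreover have "0 \<le> cube_mean n (\<lambda>x. ((t x - t (map uminus x)) / 2)\<^sup>2)"
    by (rule cube_mean_nonneg) simp
  \<comment> \<open>The extra summand of \<open>dirichlet_Suc'\<close> already supplies the whole
    mean square of t.\<close>
  moreover have "0 \<le> dirichlet n t" by (rule dirichlet_nonneg)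
  ultimately show ?case
    using Suc[of s] dirichlet_Suc'[of n F, folded s_def t_def]
      cube_mean_Suc_square[of n F, folded s_def t_def]
    by linarith
qed simp

lemma poincare_even_part:
  "2 * cube_mean n (\<lambda>x. (F x)\<^sup>2) \<le> dirichlet n F
     + cube_mean n (\<lambda>x. ((F x - F (map uminus x)) / 2)\<^sup>2) + 2 * (cube_mean n F)\<^sup>2"
proof (induction n arbitrary: F)
  case (Suc n)
  define s where "s x = (F (1 # x) + F ((-1) # x)) / 2" for x
  define t where "t x = (F (1 # x) - F ((-1) # x)) / 2" for x
  have "cube_mean (Suc n) (\<lambda>x. ((F x - F (map uminus x)) / 2)\<^sup>2)
      = cube_mean n (\<lambda>x. ((s x - s (map uminus x)) / 2)\<^sup>2)
      + cube_mean n (\<lambda>x. ((t x + t (map uminus x)) / 2)\<^sup>2)"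
    unfolding cube_mean_Suc_square
    by (intro arg_cong2[where f = "(+)"] cube_mean_cong) (simp_all add: s_def t_def field_simps)
  moreover have mean: "cube_mean (Suc n) F = cube_mean n s"
    using cube_mean_cmult[of n "1/2" "\<lambda>x. F (1 # x) + F ((-1) # x)"]
    by (simp add: s_def[abs_def] cube_mean_add)
  \<comment> \<open>The mean square of t is needed twice: once from the extra summand of
    \<open>dirichlet_Suc'\<close>, once from \<open>poincare_odd_part\<close>, whose remainder is
    the even part of t found above.\<close>
  ultimately show ?case
    using Suc[of s] poincare_odd_part[of n t] dirichlet_Suc'[of n F, folded s_def t_def]
      cube_mean_Suc_square[of n F, folded s_def t_def]
    unfolding mean by linarith
qed simp

section \<open>Sign sums and Khintchine's inequality with constant 1 / sqrt 2\<close>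

definition sign_sum :: "(nat \<Rightarrow> real) \<Rightarrow> real list \<Rightarrow> real" where
  "sign_sum a x = (\<Sum>i<length x. x ! i * a i)"

lemma sign_sum_Cons: "sign_sum a (e # x) = e * a 0 + sign_sum (\<lambda>i. a (Suc i)) x"
  unfolding sign_sum_def by (simp del: sum.lessThan_Suc add: sum.lessThan_Suc_shift)

lemma sign_sum_uminus: "sign_sum a (map uminus x) = - sign_sum a x"
  unfolding sign_sum_def by (simp add: sum_negf)

text \<open>Triangle inequality: flipping entry i subtracts twice its summand, so the flipped values
  add up to the expression on the left. The shift c lets the induction absorb the first
  summand.\<close>

lemma flip_sum_abs:
  "\<bar>real (length x) * (c + sign_sum a x) - 2 * sign_sum a x\<bar> \<le> flip_sum (\<lambda>y. \<bar>c + sign_sum a y\<bar>) x"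
proof (induction x arbitrary: a c)
  case Nil
  then show ?case by (simp add: flip_sum_def sign_sum_def)
next
  case (Cons e x)
  show ?case
    using Cons[of "c + e * a 0" "\<lambda>i. a (Suc i)"]
    by (simp add: sign_sum_Cons flip_sum_Cons algebra_simps)
qed

lemma cube_mean_sign_sum_square:
  "cube_mean n (\<lambda>x. (c + sign_sum a x)\<^sup>2) = c\<^sup>2 + (\<Sum>i<n. (a i)\<^sup>2)"
proof (induction n arbitrary: a c)
  case 0
  then show ?case by (simp add: sign_sum_def)
next
  case (Suc n)
  show ?case
    using Suc[of "c + a 0" "\<lambda>i. a (Suc i)"] Suc[of "c - a 0" "\<lambda>i. a (Suc i)"]
    by (simp add: sign_sum_Cons add.assoc sum.lessThan_Suc_shift del: sum.lessThan_Suc)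
      (simp add: algebra_simps power2_eq_square)
qed

text \<open>For S the sign sum, \<open>flip_sum_abs\<close> bounds the Dirichlet form of |S| by E
  S^2. As |S| is even, the odd remainder in \<open>poincare_even_part\<close> vanishes, leaving 2 E
  S^2 <= E S^2 + 2 (E |S|)^2.\<close>

lemma khintchine_one:
  "sqrt (\<Sum>i<n. (a i)\<^sup>2) / sqrt 2 \<le> cube_mean n (\<lambda>x. \<bar>sign_sum a x\<bar>)"
proof -
  let ?f = "\<lambda>x. \<bar>sign_sum a x\<bar>"
  have le: "?f x * (real n * ?f x - flip_sum ?f x) \<le> 2 * (?f x)\<^sup>2" if "length x = n" for x
  proof -
    have "real n * ?f x - 2 * ?f x \<le> \<bar>real n * sign_sum a x - 2 * sign_sum a x\<bar>"
      using abs_triangle_ineq2[of "real n * sign_sum a x" "2 * sign_sum a x"] by (simp add: abs_mult)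
    then have "real n * ?f x - flip_sum ?f x \<le> 2 * ?f x"
      using flip_sum_abs[of x 0 a] that by simp
    from mult_left_mono[OF this, of "?f x"] show ?thesis by (simp add: power2_eq_square)
  qed
  have "dirichlet n ?f \<le> cube_mean n (\<lambda>x. 2 * (?f x)\<^sup>2) / 2"
    unfolding dirichlet_def by (intro divide_right_mono cube_mean_mono le) auto
  then have "dirichlet n ?f \<le> cube_mean n (\<lambda>x. (?f x)\<^sup>2)"
    unfolding cube_mean_cmult by simp
  then have "cube_mean n (\<lambda>x. (?f x)\<^sup>2) \<le> 2 * (cube_mean n ?f)\<^sup>2"
    using poincare_even_part[of n ?f] by (simp add: sign_sum_uminus cube_mean_const)
  then have "(\<Sum>i<n. (a i)\<^sup>2) / 2 \<le> (cube_mean n ?f)\<^sup>2"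
    using cube_mean_sign_sum_square[of n 0 a] by simp
  then have "sqrt ((\<Sum>i<n. (a i)\<^sup>2) / 2) \<le> cube_mean n ?f"
    by (intro real_le_lsqrt cube_mean_nonneg) auto
  then show ?thesis by (simp add: real_sqrt_divide)
qed

subsection \<open>Finite-dimensional normed spaces\<close>

text \<open>Bolzano-Weierstrass, adjoining one vector b at a time. The induction hypothesis makes
  \<open>span B\<close> closed, so a new b has distance at least d > 0 from it. This bounds the
  coefficients of b, and subsequences are taken first for them, then for the remainders.\<close>

lemma finite_span_seq_compact:
  fixes B :: "'v::real_normed_vector set"
  assumes "finite B" "\<And>n. f n \<in> span B" "bounded (range f)"
  shows "\<exists>l\<in>span B. \<exists>r. strict_mono (r :: nat \<Rightarrow> nat) \<and> (f \<circ> r) \<longlonglongrightarrow> l"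
  using assms
proof (induction B arbitrary: f rule: finite_induct)
  case empty
  then have "f = (\<lambda>_. 0)" by auto
  then show ?case
    by (intro bexI[of _ 0] exI[of _ id]) (auto simp: strict_mono_def)
next
  case (insert b B)
  show ?case
  proof (cases "b \<in> span B")
    case True
    then have eq: "span (insert b B) = span B" by (rule span_redundant)
    show ?thesis using insert.IH[of f] insert.prems unfolding eq by blast
  next
    case False
    have closed: "closed (span B)"
      unfolding closed_sequential_limits
    proof (intro allI impI)
      fix x l assume x: "(\<forall>n. x n \<in> span B) \<and> x \<longlonglongrightarrow> l"
      then obtain l' r where l': "l' \<in> span B" "strict_mono (r :: nat \<Rightarrow> nat)" "(x \<circ> r) \<longlonglongrightarrow> l'"
        using insert.IH[of x] convergent_imp_bounded[of x l] by blast
      have "(x \<circ> r) \<longlonglongrightarrow> l" using x l'(2) LIMSEQ_subseq_LIMSEQ by blast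
      then show "l \<in> span B" using l'(1) LIMSEQ_unique[OF l'(3)] by simp
    qed
    obtain d where d: "d > 0" "\<And>y. y \<in> span B \<Longrightarrow> d \<le> dist b y"
    proof -
      obtain e where e: "e > 0" "ball b e \<subseteq> - span B"
        using openE[OF open_Compl[OF closed], of b] False by auto
      have "e \<le> dist b y" if "y \<in> span B" for y
        using subsetD[OF e(2), of y] that by (cases "dist b y < e") auto
      then show ?thesis using that[of e] e(1) by blast
    qed
    \<comment> \<open>For nonzero k, x / k is b minus an element of \<open>span B\<close>.\<close>
    have coef: "\<bar>k\<bar> * d \<le> norm x" if "x - k *\<^sub>R b \<in> span B" for x k
    proof (cases "k = 0")
      case False
      have "- (1 / k) *\<^sub>R (x - k *\<^sub>R b) \<in> span B" using that by (rule span_scale)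
      then have "d \<le> norm (b - (- (1 / k) *\<^sub>R (x - k *\<^sub>R b)))" using d(2) unfolding dist_norm by blast
      also have "b - (- (1 / k) *\<^sub>R (x - k *\<^sub>R b)) = (1 / k) *\<^sub>R x"
        using False by (simp add: scaleR_right_diff_distrib)
      finally show ?thesis using False by (simp add: field_simps)
    qed simp
    obtain k where k: "\<And>n. f n - k n *\<^sub>R b \<in> span B"
      using choice[of "\<lambda>n k. f n - k *\<^sub>R b \<in> span B"] insert.prems(1)
      unfolding span_insert by blast
    obtain C where C: "\<And>n. norm (f n) \<le> C"
      using insert.prems(2) by (auto simp: bounded_iff)
    have kb: "\<bar>k n\<bar> \<le> C / d" for n
      using coef[OF k[of n]] C[of n] d(1) by (simp add: field_simps)
    then have "bounded (range k)" by (intro boundedI[of _ "C / d"]) auto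
    then obtain c r where r: "strict_mono (r :: nat \<Rightarrow> nat)" "(k \<circ> r) \<longlonglongrightarrow> c"
      using bounded_imp_convergent_subsequence by blast
    define g where "g n = f (r n) - k (r n) *\<^sub>R b" for n
    have "norm (g n) \<le> C + C / d * norm b" for n
      unfolding g_def
      by (rule order_trans[OF norm_triangle_ineq4])
        (use C mult_right_mono[OF kb norm_ge_zero] in \<open>auto intro: add_mono\<close>)
    then have "bounded (range g)" by (intro boundedI[of _ "C + C / d * norm b"]) auto
    moreover have "g n \<in> span B" for n unfolding g_def by (rule k)
    ultimately obtain l s where s: "l \<in> span B" "strict_mono (s :: nat \<Rightarrow> nat)" "(g \<circ> s) \<longlonglongrightarrow> l"
      using insert.IH[of g] by blast
    have "(\<lambda>n. (g \<circ> s) n + ((k \<circ> r) \<circ> s) n *\<^sub>R b) \<longlonglongrightarrow> l + c *\<^sub>R b"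
      by (intro tendsto_intros s(3) LIMSEQ_subseq_LIMSEQ[OF r(2) s(2)])
    then have "(f \<circ> (r \<circ> s)) \<longlonglongrightarrow> l + c *\<^sub>R b" by (simp add: g_def o_def)
    moreover have "l + c *\<^sub>R b \<in> span (insert b B)"
      unfolding span_insert mem_Collect_eq using s(1) by (intro exI[of _ c]) simp
    ultimately show ?thesis using strict_mono_o[OF r(1) s(2)] by blast
  qed
qed

lemma finite_span_compact:
  fixes K :: "'v::real_normed_vector set"
  assumes "finite B" "span B = (UNIV :: 'v set)" "bounded K" "closed K"
  shows "compact K"
  unfolding compact_eq_seq_compact_metric seq_compact_def
proof (intro allI impI)
  fix f :: "nat \<Rightarrow> 'v" assume f: "\<forall>n. f n \<in> K"
  then have "bounded (range f)" using assms(3) by (auto intro: bounded_subset)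
  then obtain l r where r: "strict_mono (r :: nat \<Rightarrow> nat)" "(f \<circ> r) \<longlonglongrightarrow> l"
    using finite_span_seq_compact[of B f] assms by auto
  then have "l \<in> K" using f closed_sequentially[OF assms(4), of "f \<circ> r" l] by simp
  then show "\<exists>l\<in>K. \<exists>r. strict_mono r \<and> (f \<circ> r) \<longlonglongrightarrow> l" using r by blast
qed

section \<open>Norming functionals by a finite-dimensional Hahn-Banach argument\<close>

lemma separating_functional:
  fixes b :: "'v::real_vector"
  assumes "b \<notin> span S"
  shows "\<exists>g :: 'v \<Rightarrow> real. linear g \<and> g b = 1 \<and> (\<forall>x\<in>span S. g x = 0)"
proof -
  obtain C where C: "C \<subseteq> S" "independent C" "span C = span S"
  proof -
    obtain C where C: "C \<subseteq> S" "independent C" "S \<subseteq> span C"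
      using maximal_independent_subset[of S] by auto
    then have "span C = span S"
      by (intro antisym span_mono span_minimal subspace_span)
    then show ?thesis using that C by simp
  qed
  then have "independent (insert b C)" using assms by (simp add: independent_insert)
  then obtain g :: "'v \<Rightarrow> real" where g: "linear g" "\<forall>x\<in>insert b C. g x = (if x = b then 1 else 0)"
    using linear_independent_extend[of "insert b C" "\<lambda>x. if x = b then 1 else 0 :: real"] by blast
  have "b \<notin> C" using assms C(3) span_base[of b C] by auto
  then have "g y = 0" if "y \<in> C" for y using g(2) that by auto
  then have "g x = 0" if "x \<in> span C" for x
    using linear_eq_on[OF g(1) linear_zero that] by simp
  then show ?thesis using g unfolding C(3) by (intro exI[of _ g]) simp
qed

text \<open>One Hahn-Banach step. The value at b must lie between all f x - |x - b| and all |y + b|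
  - f y; the triangle inequality leaves room, and the supremum c of the lower bounds is
  chosen.\<close>

lemma dominated_extend:
  fixes f :: "'v::real_normed_vector \<Rightarrow> real"
  assumes "linear f" "\<And>x. x \<in> span S \<Longrightarrow> f x \<le> norm x"
  shows "\<exists>g. linear g \<and> (\<forall>x\<in>span S. g x = f x) \<and> (\<forall>x\<in>span (insert b S). g x \<le> norm x)"
proof (cases "b \<in> span S")
  case True
  then have "span (insert b S) = span S" by (rule span_redundant)
  then show ?thesis using assms by auto
next
  case False
  obtain h :: "'v \<Rightarrow> real" where h: "linear h" "h b = 1" "\<And>x. x \<in> span S \<Longrightarrow> h x = 0"
    using separating_functional[OF False] by blast
  define c where "c = (SUP x\<in>span S. f x - norm (x - b))"
  have le: "f x - norm (x - b) \<le> norm (y + b) - f y" if "x \<in> span S" "y \<in> span S" for x y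
  proof -
    have "f x + f y \<le> norm (x + y)"
      using assms(2)[OF span_add[OF that]] linear_add[OF assms(1)] by simp
    also have "\<dots> \<le> norm (x - b) + norm (y + b)"
      using norm_triangle_ineq[of "x - b" "y + b"] by simp
    finally show ?thesis by simp
  qed
  have "bdd_above ((\<lambda>x. f x - norm (x - b)) ` span S)"
    using le[OF _ span_zero] by (auto intro!: bdd_aboveI2)
  then have c1: "f x - norm (x - b) \<le> c" if "x \<in> span S" for x
    unfolding c_def using that by (intro cSUP_upper) auto
  have c2: "c \<le> norm (y + b) - f y" if "y \<in> span S" for y
    unfolding c_def using le that span_zero by (intro cSUP_least) auto
  \<comment> \<open>As h is the coordinate along b, this keeps f on \<open>span S\<close> and takes
    the value c at b.\<close>
  define g where "g x = f x + (c - f b) * h x" for x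
  have "linear g"
    unfolding g_def using linear_compose_add[OF assms(1) linear_compose_scale_right[OF h(1)]] by simp
  moreover have "g x = f x" if "x \<in> span S" for x using h(3)[OF that] by (simp add: g_def)
  moreover have "g x \<le> norm x" if x: "x \<in> span (insert b S)" for x
  proof -
    obtain t where t: "x - t *\<^sub>R b \<in> span S" using x unfolding span_insert by blast
    define y where "y = x - t *\<^sub>R b"
    have y: "y \<in> span S" "x = y + t *\<^sub>R b" using t by (auto simp: y_def)
    have gx: "g x = f y + t * c"
      using h(2) h(3)[OF y(1)]
      by (simp add: g_def y(2) linear_add[OF assms(1)] linear_scale[OF assms(1)]
        linear_add[OF h(1)] linear_scale[OF h(1)] algebra_simps)
    have *: "(1 / \<bar>t\<bar>) *\<^sub>R y \<in> span S" using y(1) by (rule span_scale)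
    have **: "f ((1 / \<bar>t\<bar>) *\<^sub>R y) = f y / \<bar>t\<bar>"
      using linear_scale[OF assms(1), of "1 / \<bar>t\<bar>" y] by simp
    \<comment> \<open>Dividing by |t| reduces to coefficient 1, where \<open>c2\<close> applies, or
      -1, where \<open>c1\<close> applies.\<close>
    consider "t = 0" | "t > 0" | "t < 0" by linarith
    then show ?thesis
    proof cases
      case 1
      then show ?thesis using gx y assms(2) by simp
    next
      case 2
      have "t * c \<le> t * (norm ((1 / \<bar>t\<bar>) *\<^sub>R y + b) - f ((1 / \<bar>t\<bar>) *\<^sub>R y))"
        using c2[OF *] 2 by simp
      also have "\<dots> = norm (t *\<^sub>R ((1 / \<bar>t\<bar>) *\<^sub>R y + b)) - f y"
        unfolding ** using 2 by (simp add: right_diff_distrib)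
      also have "t *\<^sub>R ((1 / \<bar>t\<bar>) *\<^sub>R y + b) = x"
        using 2 y(2) by (simp add: scaleR_add_right)
      finally show ?thesis using gx by simp
    next
      case 3
      have "(-t) * (f ((1 / \<bar>t\<bar>) *\<^sub>R y) - norm ((1 / \<bar>t\<bar>) *\<^sub>R y - b)) \<le> (-t) * c"
        using 3 by (intro mult_left_mono c1[OF *]) auto
      also have "(-t) * (f ((1 / \<bar>t\<bar>) *\<^sub>R y) - norm ((1 / \<bar>t\<bar>) *\<^sub>R y - b))
          = f y - norm ((-t) *\<^sub>R ((1 / \<bar>t\<bar>) *\<^sub>R y - b))"
        unfolding ** using 3 by (simp add: right_diff_distrib)
      also have "(-t) *\<^sub>R ((1 / \<bar>t\<bar>) *\<^sub>R y - b) = x"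
        using 3 y(2) by (simp add: scaleR_diff_right)
      finally show ?thesis using gx by simp
    qed
  qed
  ultimately show ?thesis by blast
qed

text \<open>The functional sending k v to k |v| is dominated by the norm on the line of v and is
  extended through the vectors of B. Domination at x and -x bounds its norm by 1; the value at v
  shows equality.\<close>

lemma norming_functional:
  fixes v :: "'v::real_normed_vector"
  assumes "finite B" "span B = (UNIV :: 'v set)" "v \<noteq> 0"
  obtains L :: "'v \<Rightarrow>\<^sub>L real" where "norm L = 1" "blinfun_apply L v = norm v"
proof -
  have "\<exists>f. linear f \<and> f v = norm v \<and> (\<forall>x\<in>span (insert v B). f x \<le> norm x)"
    using assms(1)
  proof (induction B rule: finite_induct)
    case empty
    have "v \<notin> span {}" using assms(3) by simp
    then obtain h :: "'v \<Rightarrow> real" where h: "linear h" "h v = 1"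
      using separating_functional[of v "{}"] by blast
    have "norm v * h x \<le> norm x" if x: "x \<in> span {v}" for x
    proof -
      obtain k where "x - k *\<^sub>R v \<in> span {}" using x unfolding span_insert by blast
      then have "x = k *\<^sub>R v" by simp
      then show ?thesis
        by (simp add: linear_scale[OF h(1)] h(2) mult.commute mult_right_mono)
    qed
    moreover have "linear (\<lambda>x. norm v * h x)"
      using linear_compose_scale_right[OF h(1)] by simp
    ultimately show ?case using h(2) by (intro exI[of _ "\<lambda>x. norm v * h x"]) auto
  next
    case (insert b B)
    then obtain f where f: "linear f" "f v = norm v" "\<And>x. x \<in> span (insert v B) \<Longrightarrow> f x \<le> norm x"
      by blast
    obtain g where "linear g" "\<forall>x\<in>span (insert v B). g x = f x"
        "\<forall>x\<in>span (insert b (insert v B)). g x \<le> norm x"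
      using dominated_extend[OF f(1,3)] by blast
    moreover have "v \<in> span (insert v B)" by (simp add: span_base)
    ultimately show ?case using f(2) unfolding insert_commute[of v b] by auto
  qed
  then obtain f :: "'v \<Rightarrow> real" where f: "linear f" "f v = norm v" "\<And>x. x \<in> span (insert v B) \<Longrightarrow> f x \<le> norm x"
    by blast
  have "span (insert v B) = UNIV" using assms(2) span_mono[of B "insert v B"] by auto
  then have le: "f x \<le> norm x" for x using f(3) by blast
  have abs: "\<bar>f x\<bar> \<le> 1 * norm x" for x
    using le[of x] le[of "- x"] linear_neg[OF f(1)] by simp
  then have bl: "bounded_linear f"
    using f(1) by (auto simp: bounded_linear_def bounded_linear_axioms_def mult.commute intro!: exI[of _ 1])
  define L where "L = Blinfun f"
  have L: "blinfun_apply L = f" unfolding L_def using bl by (rule bounded_linear_Blinfun_apply)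
  have "norm L \<le> 1" using abs by (intro norm_blinfun_bound) (auto simp: L)
  moreover have "norm v \<le> norm L * norm v" using norm_blinfun[of L v] by (simp add: L f(2))
  then have "1 \<le> norm L" using assms(3) by simp
  ultimately show ?thesis using that[of L] f(2) by (simp add: L)
qed

subsection \<open>Regret against aligned random losses\<close>

lemma integrable_loss:
  fixes L :: "'v::real_normed_vector \<Rightarrow>\<^sub>L real"
  assumes "bounded K" "randomized_algorithm K M A"
  shows "integrable M (\<lambda>\<omega>. L (A \<omega> h))"
proof -
  interpret prob_space M using assms(2) by (simp add: randomized_algorithm_def)
  obtain B where B: "\<And>p. p \<in> K \<Longrightarrow> norm p \<le> B"
    using assms(1) by (auto simp: bounded_iff)
  have [measurable]: "(\<lambda>\<omega>. A \<omega> h) \<in> borel_measurable M"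
    using assms(2) by (simp add: randomized_algorithm_def)
  have "continuous_on UNIV (blinfun_apply L)"
    by (intro linear_continuous_on blinfun.bounded_linear_right)
  then have [measurable]: "blinfun_apply L \<in> borel_measurable borel"
    by (rule borel_measurable_continuous_onI)
  have "norm (L (A \<omega> h)) \<le> norm L * B" if "\<omega> \<in> space M" for \<omega>
  proof -
    have "norm (A \<omega> h) \<le> B"
      using assms(2) that by (intro B) (simp add: randomized_algorithm_def)
    then show ?thesis
      using norm_blinfun[of L "A \<omega> h"] mult_left_mono[OF _ norm_ge_zero] by (meson order_trans)
  qed
  then show ?thesis
    by (intro integrable_const_bound[of _ "norm L * B"]) auto
qed

text \<open>For parallel losses the comparator term depends only on the sum S of the coefficients,
  so its supremum C does not depend on the seed. Centring at L (u + v) / 2 isolates a sum that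
  random signs will average to zero.\<close>

lemma expected_regret_parallel_losses:
  fixes L :: "'v::real_normed_vector \<Rightarrow>\<^sub>L real" and c :: "nat \<Rightarrow> real"
  assumes "bounded K" "randomized_algorithm K M A" "u \<in> K" "v \<in> K"
  defines "l \<equiv> \<lambda>t. c t *\<^sub>R L"
  shows "(\<Sum>i<T. c (Suc i) * ((\<integral>\<omega>. L (A \<omega> (map l [1..<Suc i])) \<partial>M) - L (u + v) / 2))
      + L (u - v) / 2 * \<bar>\<Sum>i<T. c (Suc i)\<bar> \<le> expected_regret K M A l T"
proof -
  interpret prob_space M using assms(2) by (simp add: randomized_algorithm_def)
  define S where "S = (\<Sum>i<T. c (Suc i))"
  define C where "C = (SUP p\<in>K. - (S * L p))"
  define R where "R \<omega> = (\<Sum>i<T. c (Suc i) * L (A \<omega> (map l [1..<Suc i])))" for \<omega>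
  obtain B where B: "\<And>p. p \<in> K \<Longrightarrow> norm p \<le> B"
    using assms(1) by (auto simp: bounded_iff)
  have "- (S * L p) \<le> \<bar>S\<bar> * (norm L * B)" if "p \<in> K" for p
  proof -
    have "- (S * L p) \<le> \<bar>S\<bar> * \<bar>L p\<bar>" by (metis abs_ge_minus_self abs_mult)
    also have "\<bar>L p\<bar> \<le> norm L * B"
      using norm_blinfun[of L p] mult_left_mono[OF B[OF that] norm_ge_zero[of L]] by simp
    finally show ?thesis by (simp add: mult_left_mono)
  qed
  then have bdd: "bdd_above ((\<lambda>p. - (S * L p)) ` K)" by (rule bdd_aboveI2)
  have "regret_wrt (play (A \<omega>) l) l T p = R \<omega> + - (S * L p)" for \<omega> p
    by (simp add: regret_wrt_def sum.atLeast1_atMost_eq R_def S_def play_def l_def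
        blinfun.scaleR_left sum_distrib_right)
  then have regret: "regret K (play (A \<omega>) l) l T = R \<omega> + C" for \<omega>
    unfolding regret_def C_def using Sup_add_eq[OF bdd] assms(3) by auto
  have int: "integrable M (\<lambda>\<omega>. L (A \<omega> h))" for h
    using assms(1,2) by (rule integrable_loss)
  have "expected_regret K M A l T = (\<integral>\<omega>. R \<omega> \<partial>M) + C"
    unfolding expected_regret_def regret R_def
    by (subst Bochner_Integration.integral_add) (auto intro!: int simp: prob_space)
  also have "(\<integral>\<omega>. R \<omega> \<partial>M) = (\<Sum>i<T. c (Suc i) * (\<integral>\<omega>. L (A \<omega> (map l [1..<Suc i])) \<partial>M))"
    unfolding R_def by (subst Bochner_Integration.integral_sum) (auto intro!: int)
  finally have eq: "expected_regret K M A l T = \<dots> + C" .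
  have "- (S * L u) \<le> C" "- (S * L v) \<le> C"
    unfolding C_def using assms(3,4) by (auto intro: cSUP_upper[OF _ bdd])
  \<comment> \<open>The left side equals the comparator term of v if S >= 0, and that of u
    otherwise.\<close>
  then have "L (u - v) / 2 * \<bar>S\<bar> - S * (L (u + v) / 2) \<le> C"
    by (cases "0 \<le> S") (simp_all add: blinfun.diff_right blinfun.add_right field_simps)
  then show ?thesis
    unfolding eq S_def by (simp add: right_diff_distrib sum_subtractf sum_distrib_right sum_divide_distrib)
qed

lemma norming_functional_diameter:
  fixes K :: "'v::real_normed_vector set"
  assumes "finite B" "span B = (UNIV :: 'v set)" "compact K" "K \<noteq> {}" "\<exists>x :: 'v. x \<noteq> 0"
  obtains L :: "'v \<Rightarrow>\<^sub>L real" and u v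
  where "norm L = 1" "u \<in> K" "v \<in> K" "L (u - v) = diameter K"
proof -
  obtain u v where uv: "u \<in> K" "v \<in> K" "dist u v = diameter K"
    using diameter_compact_attained[OF assms(3,4)] by blast
  \<comment> \<open>If u = v, the diameter is 0 and any norm-one functional serves, so x may be any
    nonzero vector.\<close>
  obtain x :: 'v where x: "x \<noteq> 0" "u \<noteq> v \<Longrightarrow> x = u - v"
    using assms(5) by (cases "u = v") auto
  obtain L :: "'v \<Rightarrow>\<^sub>L real" where L: "norm L = 1" "L x = norm x"
    using norming_functional[OF assms(1,2) x(1)] .
  have "L (u - v) = diameter K"
    using uv(3) x(2) L(2) by (cases "u = v") (auto simp: dist_norm)
  with L(1) uv(1,2) show ?thesis using that by blast
qed

text \<open>The zero space has only the zero functional, so positive norms cannot be prescribed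
  there; \<open>nontrivial\<close> expresses this.\<close>

theorem theorem3:
  fixes K :: "'v::real_normed_vector set"
    and M :: "'s measure"
    and A :: "'s \<Rightarrow> ('v \<Rightarrow>\<^sub>L real) list \<Rightarrow> 'v"
    and T :: nat
    and a :: "nat \<Rightarrow> real"
  assumes fin_dim: "\<exists>B :: 'v set. finite B \<and> span B = UNIV"
    and K: "K \<noteq> {}" "bounded K" "closed K" "convex K"
    and alg: "randomized_algorithm K M A"
    and a_nonneg: "\<And>t. t \<in> {1..T} \<Longrightarrow> a t \<ge> 0"
    and nontrivial: "(\<exists>x :: 'v. x \<noteq> 0) \<or> (\<forall>t \<in> {1..T}. a t = 0)"
  shows "\<exists>l :: nat \<Rightarrow> 'v \<Rightarrow>\<^sub>L real.
    (\<forall>t \<in> {1..T}. norm (l t) = a t) \<and>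
    expected_regret K M A l T \<ge> diameter K / sqrt 8 * sqrt (\<Sum>t = 1..T. (norm (l t))\<^sup>2)"
proof -
  obtain B :: "'v set" where B: "finite B" "span B = UNIV" using fin_dim by blast
  have compact: "compact K" using finite_span_compact[OF B K(2,3)] .
  obtain L :: "'v \<Rightarrow>\<^sub>L real" and u v where L: "norm L = 1 \<or> (\<forall>t\<in>{1..T}. a t = 0)"
    and uv: "u \<in> K" "v \<in> K" and D: "L (u - v) = diameter K"
  proof (cases "\<exists>x :: 'v. x \<noteq> 0")
    case True
    then show ?thesis using norming_functional_diameter[OF B compact K(1)] that by metis
  next
    case False
    obtain u v where "u \<in> K" "v \<in> K" "dist u v = diameter K"
      using diameter_compact_attained[OF compact K(1)] by blast
    moreover from this False have "diameter K = 0" by (metis dist_self)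
    ultimately show ?thesis using that[of 0 u v] False nontrivial by simp
  qed
  \<comment> \<open>Rounds count from 1 and list positions from 0.\<close>
  define l where "l x t = (x ! (t - 1) * a t) *\<^sub>R L" for x :: "real list" and t
  define F where "F x = expected_regret K M A (l x) T" for x
  \<comment> \<open>The centred expected loss of the round after history h. It reads
    \<open>l h\<close> only up to round \<open>length h\<close>, hence only entries of h, as
    \<open>cube_mean_martingale\<close> requires.\<close>
  define \<phi> where "\<phi> h = a (Suc (length h)) *
      ((\<integral>\<omega>. L (A \<omega> (map (l h) [1..<Suc (length h)])) \<partial>M) - L (u + v) / 2)" for h
  let ?a = "\<lambda>i. a (Suc i)"
  have lower: "(\<Sum>i<T. x ! i * \<phi> (take i x)) + diameter K / 2 * \<bar>sign_sum ?a x\<bar> \<le> F x"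
    if x: "length x = T" for x
  proof -
    have "x ! i * a (Suc i) * ((\<integral>\<omega>. L (A \<omega> (map (l x) [1..<Suc i])) \<partial>M) - L (u + v) / 2)
        = x ! i * \<phi> (take i x)" if "i < T" for i
    proof -
      have hist: "map (l x) [1..<Suc i] = map (l (take i x)) [1..<Suc i]"
        by (auto simp: l_def)
      have len: "length (take i x) = i" using that x by simp
      show ?thesis unfolding \<phi>_def len hist by (simp only: mult.assoc)
    qed
    then have sum: "(\<Sum>i<T. x ! i * a (Suc i) *
          ((\<integral>\<omega>. L (A \<omega> (map (l x) [1..<Suc i])) \<partial>M) - L (u + v) / 2)) = (\<Sum>i<T. x ! i * \<phi> (take i x))"
      by (intro sum.cong) (simp_all only: lessThan_iff)
    have l: "l x = (\<lambda>t. (x ! (t - 1) * a t) *\<^sub>R L)"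
      by (simp add: l_def fun_eq_iff)
    show ?thesis
      using expected_regret_parallel_losses[OF K(2) alg uv, where T = T and L = L
          and c = "\<lambda>t. x ! (t - 1) * a t", folded l]
      unfolding F_def D sign_sum_def x diff_Suc_1 sum .
  qed
  \<comment> \<open>sqrt 8 = 2 sqrt 2: the 2 comes from comparing with the better of u and v, the
    sqrt 2 from Khintchine.\<close>
  have "diameter K / sqrt 8 * sqrt (\<Sum>i<T. (?a i)\<^sup>2)
      = diameter K / 2 * (sqrt (\<Sum>i<T. (?a i)\<^sup>2) / sqrt 2)"
    using real_sqrt_mult[of 4 2] by simp
  also have "\<dots> \<le> diameter K / 2 * cube_mean T (\<lambda>x. \<bar>sign_sum ?a x\<bar>)"
    by (intro mult_left_mono khintchine_one) (simp add: diameter_ge_0 K(2))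
  also have "\<dots> = cube_mean T (\<lambda>x. (\<Sum>i<T. x ! i * \<phi> (take i x)) + diameter K / 2 * \<bar>sign_sum ?a x\<bar>)"
    by (simp only: cube_mean_add cube_mean_cmult cube_mean_martingale)
  also have "\<dots> \<le> cube_mean T F" by (intro cube_mean_mono lower)
  finally have mean: "diameter K / sqrt 8 * sqrt (\<Sum>i<T. (?a i)\<^sup>2) \<le> cube_mean T F" .
  obtain x where x: "length x = T" "set x \<subseteq> {1, -1}" "cube_mean T F \<le> F x"
    using cube_mean_le_value by blast
  have norm: "norm (l x t) = a t" if t: "t \<in> {1..T}" for t
  proof -
    have "x ! (t - 1) \<in> set x" using t x(1) by (intro nth_mem) auto
    then have "\<bar>x ! (t - 1)\<bar> = 1" using x(2) by auto
    \<comment> \<open>If L does not have norm 1, then \<open>a t\<close> is 0 and so is the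
      loss.\<close>
    then show ?thesis using L a_nonneg[OF t] t by (auto simp: l_def abs_mult)
  qed
  have "(\<Sum>t = 1..T. (norm (l x t))\<^sup>2) = (\<Sum>t = 1..T. (a t)\<^sup>2)"
    by (intro sum.cong) (simp_all add: norm)
  then have "diameter K / sqrt 8 * sqrt (\<Sum>t = 1..T. (norm (l x t))\<^sup>2) \<le> expected_regret K M A (l x) T"
    using mean x(3) by (simp add: F_def sum.atLeast1_atMost_eq)
  then show ?thesis using norm by blast
qed

end
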